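(* Let $(\varphi_1,\varphi_2,\varphi_3)\in (J\setminus\pi\mathbb Z)^3$, where $J=(0,\infty)\setminus\{\pi\}$, and suppose that there exists a symmetric trinoid with ends marked $1,2,3$ whose $i$-th end is asymptotic to the catenoid cousin $C_{\lambda_i}$ with $\tilde\varphi(\lambda_i)=\varphi_i$ for $i=1,2,3$. Assume that the triple $(\varphi_1,\varphi_2,\varphi_3)$ is generic. Then $$(r(\varphi_1),r(\varphi_2),r(\varphi_3))\in\mathcal T .$$
   Context: A Bryant surface is an immersed surface of constant mean curvature 1 in $\mathbb H^3$. Put $I=(-\tfrac14,\infty)\setminus\{0\}$. For $\lambda\in I$, the catenoid cousin $C_\lambda$ is the Bryant surface which under Bryant's representation has the data $g=e^z$, $\omega=\lambda e^{-z}dz$ (locally $FF^*$ with $F$ holomorphic in $SL(2,\mathbb C)$, $F^{-1}dF=\begin{pmatrix} g&-g^2\\1&-g\end{pmatrix}\omega$). The helicoid $H_\lambda$ in $\mathbb R^3$ is $H_\lambda(x+iy)=2\lambda(\sinh x\sin y,-\sinh x\cos y,-y)$. The bijection $\tilde\varphi:I\to J$ is $\tilde\varphi(\lambda)=\pi/\sqrt{1+4\lambda}$. An annular Bryant end (domain $\{0<|z|\le1\}$) is catenoidal if it is properly embedded and asymptotic (up to isometry of $\mathbb H^3$) to a catenoid cousin $C_\lambda$; $\lambda$ is the parameter of the end. A trinoid is a properly immersed Bryant surface of genus zero with three ends, all catenoidal. A symmetric trinoid is a trinoid $T$ which has a symmetry plane $P\subset\mathbb H^3$ such that the asymptotic endpoints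 of $T$ are contained in the asymptotic boundary of $P$. Reduced angle: $r(\varphi)=\min_{n\in\mathbb Z}|\varphi+2n\pi|$. $\mathcal T$ is the set of interior points of the tetrahedron with vertices $(\pi,0,0),(0,\pi,0),(0,0,\pi),(\pi,\pi,\pi)$. Genericity. For $\varphi=\tilde\varphi(\lambda)\in J$ put $h(\varphi)=2|\lambda|\varphi$. A triple of oriented lines $(l_{12},l_{23},l_{31})$ in $\mathbb R^3$ is an admissible constellation with parameter triple $(\lambda_1,\lambda_2,\lambda_3)\in I^3$ if there are orientation-preserving isometries $I_1,I_2,I_3$ of $\mathbb R^3$ such that (indices in $\mathbb Z_3$): (i) $\{l_{12},l_{31}\}\subset I_1(H_{\lambda_1})$, $\{l_{23},l_{12}\}\subset I_2(H_{\lambda_2})$, $\{l_{31},l_{23}\}\subset I_3(H_{\lambda_3})$; (ii) rotating $l_{i(i+1)}$ inside $I_i(H_{\lambda_i})$ (i.e. moving it by the screw motions along the rulings of the helicoid) maps $l_{i(i+1)}$ to $l_{(i+2)i}$ with the opposite orientation; (iii) the distance of $l_{i(i+1)}$ and $l_{(i+2)i}$ is $h(\tilde\varphi(\lambda_i))$. A triple $(\varphi_1,\varphi_2,\varphi_3)\in J^3$ is admissible if there is an admissible constellation with parameter triple $(\tilde\varphi^{-1}(\varphi_1),\tilde\varphi^{-1}(\varphi_2),\tilde\varphi^{-1}(\varphi_3))$. An admissible triple is generic if there is a corresponding admissible constellation whose three lines are not contained in parallel planes (i.e. their directions are not all parallel to one common plane). *)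

theory Defs
  imports "HOL-Analysis.Analysis"
begin

section \<open>Hyperbolic space as a space of Hermitian matrices\<close>

text \<open>
  Hermitian 2-by-2 matrices with the Lorentzian quadratic form \<open>X \<mapsto> - det X\<close> are Minkowski
  4-space; \<open>linner\<close> is the polarization of this form. Hyperbolic 3-space (curvature -1) is the
  sheet of the hyperboloid consisting of the matrices \<open>F F\<^sup>*\<close> with \<open>det F = 1\<close>.
\<close>

definition cadjoint :: "complex^2^2 \<Rightarrow> complex^2^2" where
  "cadjoint A = (\<chi> i j. cnj (A $ j $ i))"

definition linner :: "complex^2^2 \<Rightarrow> complex^2^2 \<Rightarrow> real" where
  "linner X Y = - Re (det (X + Y) - det X - det Y) / 2"

definition hyp3 :: "(complex^2^2) set" where
  "hyp3 = {X. cadjoint X = X \<and> det X = 1 \<and> Re (trace X) > 0}"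

definition hdist :: "complex^2^2 \<Rightarrow> complex^2^2 \<Rightarrow> real" where
  "hdist X Y = arcosh (- linner X Y)"

definition hdist_set :: "complex^2^2 \<Rightarrow> (complex^2^2) set \<Rightarrow> real" where
  "hdist_set X S = (INF Y\<in>S. hdist X Y)"

definition hyp_isometry :: "(complex^2^2 \<Rightarrow> complex^2^2) \<Rightarrow> bool" where
  "hyp_isometry f \<longleftrightarrow> bij_betw f hyp3 hyp3 \<and>
     (\<forall>X\<in>hyp3. \<forall>Y\<in>hyp3. hdist (f X) (f Y) = hdist X Y)"

text \<open>
  Totally geodesic planes are the sections of the hyperboloid by hyperplanes with a spacelike
  unit normal \<open>N\<close>.
\<close>

definition spacelike_unit :: "complex^2^2 \<Rightarrow> bool" where
  "spacelike_unit N \<longleftrightarrow> cadjoint N = N \<and> linner N N = 1"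

definition hyp_plane :: "complex^2^2 \<Rightarrow> (complex^2^2) set" where
  "hyp_plane N = {X \<in> hyp3. linner X N = 0}"

definition hyp_reflection :: "complex^2^2 \<Rightarrow> complex^2^2 \<Rightarrow> complex^2^2" where
  "hyp_reflection N X = X - (2 * linner X N) *\<^sub>R N"

text \<open>
  Scaling to trace 1 gives the projective (Klein) model, an open ball whose boundary sphere, the
  sphere at infinity, consists of the singular matrices of the closed ball.
\<close>

definition klein :: "complex^2^2 \<Rightarrow> complex^2^2" where
  "klein X = (1 / Re (trace X)) *\<^sub>R X"

definition asymptotic_boundary :: "(complex^2^2) set \<Rightarrow> (complex^2^2) set" where
  "asymptotic_boundary S = {B \<in> closure (klein ` S). det B = 0}"


section \<open>Bryant surfaces\<close>

definition pdx :: "(complex \<Rightarrow> 'a::real_normed_vector) \<Rightarrow> complex \<Rightarrow> 'a" where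
  "pdx f z = frechet_derivative f (at z) 1"

definition pdy :: "(complex \<Rightarrow> 'a::real_normed_vector) \<Rightarrow> complex \<Rightarrow> 'a" where
  "pdy f z = frechet_derivative f (at z) \<i>"

primrec Ck_on :: "nat \<Rightarrow> (complex \<Rightarrow> 'a::real_normed_vector) \<Rightarrow> complex set \<Rightarrow> bool" where
  "Ck_on 0 f U \<longleftrightarrow> continuous_on U f"
| "Ck_on (Suc k) f U \<longleftrightarrow>
     (\<forall>z\<in>U. f differentiable (at z)) \<and> Ck_on k (pdx f) U \<and> Ck_on k (pdy f) U"

definition unit_normal_at :: "(complex \<Rightarrow> complex^2^2) \<Rightarrow> complex \<Rightarrow> complex^2^2 \<Rightarrow> bool" where
  "unit_normal_at f z N \<longleftrightarrow> spacelike_unit N \<and>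
     linner (f z) N = 0 \<and> linner (pdx f z) N = 0 \<and> linner (pdy f z) N = 0"

text \<open>
  Half the trace of the second with respect to the first fundamental form. Second derivatives in
  Minkowski space may be used in the second fundamental form, because they differ from the
  covariant derivatives in hyperbolic space by multiples of \<open>f z\<close>, which is orthogonal to \<open>N\<close>.
\<close>

definition mean_curvature :: "(complex \<Rightarrow> complex^2^2) \<Rightarrow> complex^2^2 \<Rightarrow> complex \<Rightarrow> real" where
  "mean_curvature f N z =
     (let E = linner (pdx f z) (pdx f z);
          F = linner (pdx f z) (pdy f z);
          G = linner (pdy f z) (pdy f z);
          L = linner (pdx (pdx f) z) N;
          M = linner (pdy (pdx f) z) N;
          K = linner (pdy (pdy f) z) N
      in (E * K - 2 * F * M + G * L) / (2 * (E * G - F\<^sup>2)))"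

text \<open>
  The unit normal may be chosen pointwise: where the mean curvature is 1 for one of the two normals,
  this normal is the mean curvature vector, so the choice depends smoothly on the point.
  The parametrization is not required to be conformal.
\<close>

definition bryant_surface_on :: "complex set \<Rightarrow> (complex \<Rightarrow> complex^2^2) \<Rightarrow> bool" where
  "bryant_surface_on U f \<longleftrightarrow> open U \<and> (\<forall>k. Ck_on k f U) \<and> f ` U \<subseteq> hyp3 \<and>
     (\<forall>z\<in>U. inj (frechet_derivative f (at z))) \<and>
     (\<forall>z\<in>U. \<exists>N. unit_normal_at f z N \<and> mean_curvature f N z = 1)"

definition mat2 :: "complex \<Rightarrow> complex \<Rightarrow> complex \<Rightarrow> complex \<Rightarrow> complex^2^2" where
  "mat2 a b c d = vector [vector [a, b], vector [c, d]]"

definition mderiv :: "(complex \<Rightarrow> complex^2^2) \<Rightarrow> complex \<Rightarrow> complex^2^2" where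
  "mderiv F z = (\<chi> i j. deriv (\<lambda>w. F w $ i $ j) z)"

text \<open>
  Bryant's representation on a domain \<open>U\<close> with data \<open>g\<close> and \<open>\<omega> = w dz\<close>.
\<close>

definition bryant_representation ::
  "complex set \<Rightarrow> (complex \<Rightarrow> complex) \<Rightarrow> (complex \<Rightarrow> complex) \<Rightarrow> (complex \<Rightarrow> complex^2^2) \<Rightarrow> bool"
  where
  "bryant_representation U g w f \<longleftrightarrow>
     (\<exists>F. (\<forall>i j. (\<lambda>z. F z $ i $ j) holomorphic_on U) \<and>
          (\<forall>z\<in>U. det (F z) = 1 \<and>
             matrix_inv (F z) ** mderiv F z
               = mat2 (g z * w z) (- ((g z)\<^sup>2 * w z)) (w z) (- (g z * w z)) \<and>
             f z = F z ** cadjoint (F z)))"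

definition lam_range :: "real set" where
  "lam_range = {-1/4<..} - {0}"

definition phi_range :: "real set" where
  "phi_range = {0<..} - {pi}"

definition phi_of :: "real \<Rightarrow> real" where
  "phi_of l = pi / sqrt (1 + 4 * l)"

text \<open>
  The matrix \<open>F\<close> is only determined up to left multiplication by a constant, so the catenoid cousin
  is determined up to isometry. Its parametrization has the period \<open>2 i phi_of l\<close>.
\<close>

definition catenoid_cousin :: "real \<Rightarrow> (complex \<Rightarrow> complex^2^2) \<Rightarrow> bool" where
  "catenoid_cousin l C \<longleftrightarrow> l \<in> lam_range \<and>
     bryant_representation UNIV exp (\<lambda>z. of_real l * exp (- z)) C"


section \<open>Catenoidal ends and trinoids\<close>

definition punctured_disc :: "complex set" where
  "punctured_disc = {z. 0 < norm z \<and> norm z \<le> 1}"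

definition annular_bryant_end :: "(complex \<Rightarrow> complex^2^2) \<Rightarrow> bool" where
  "annular_bryant_end E \<longleftrightarrow> (\<exists>U. punctured_disc \<subseteq> U \<and> bryant_surface_on U E)"

definition properly_embedded_end :: "(complex \<Rightarrow> complex^2^2) \<Rightarrow> bool" where
  "properly_embedded_end E \<longleftrightarrow>
     proper_map (top_of_set punctured_disc) (top_of_set hyp3) E \<and> inj_on E punctured_disc"

text \<open>
  The distance from each of the two surfaces to the other one tends to 0 towards infinity. The end of
  \<open>C\<close> used is \<open>Re z \<rightarrow> \<infinity>\<close>; for a catenoid cousin \<open>C\<close> the end \<open>Re z \<rightarrow> - \<infinity>\<close> is congruent to it.
\<close>

definition asymptotic_to :: "(complex \<Rightarrow> complex^2^2) \<Rightarrow> (complex \<Rightarrow> complex^2^2) \<Rightarrow> bool" where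
  "asymptotic_to E C \<longleftrightarrow>
     ((\<lambda>z. hdist_set (E z) (C ` {z. Re z \<ge> 0})) \<longlongrightarrow> 0) (at 0) \<and>
     ((\<lambda>z. hdist_set (C z) (E ` punctured_disc)) \<longlongrightarrow> 0) (filtercomap Re at_top)"

definition catenoidal_end :: "real \<Rightarrow> (complex \<Rightarrow> complex^2^2) \<Rightarrow> bool" where
  "catenoidal_end l E \<longleftrightarrow> annular_bryant_end E \<and> properly_embedded_end E \<and>
     (\<exists>C \<Phi>. catenoid_cousin l C \<and> hyp_isometry \<Phi> \<and> asymptotic_to E (\<Phi> \<circ> C))"

text \<open>
  Every sphere with three marked punctures is diffeomorphic to the sphere punctured at
  0, 1, \<open>\<infinity>\<close> (marked 1, 2, 3 in this order), and every neighbourhood of a puncture contains a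
  round one.
\<close>

definition thrice_punctured_sphere :: "complex set" where
  "thrice_punctured_sphere = UNIV - {0, 1}"

definition trinoid :: "(complex \<Rightarrow> complex^2^2) \<Rightarrow> real \<Rightarrow> real \<Rightarrow> real \<Rightarrow> bool" where
  "trinoid T l1 l2 l3 \<longleftrightarrow>
     bryant_surface_on thrice_punctured_sphere T \<and>
     proper_map (top_of_set thrice_punctured_sphere) (top_of_set hyp3) T \<and>
     (\<exists>\<rho>\<in>{0<..<1}. catenoidal_end l1 (\<lambda>z. T (of_real \<rho> * z))) \<and>
     (\<exists>\<rho>\<in>{0<..<1}. catenoidal_end l2 (\<lambda>z. T (1 + of_real \<rho> * z))) \<and>
     (\<exists>\<rho>\<in>{0<..<1}. catenoidal_end l3 (\<lambda>z. T (1 / (of_real \<rho> * z))))"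

definition symmetry_plane :: "(complex \<Rightarrow> complex^2^2) \<Rightarrow> complex^2^2 \<Rightarrow> bool" where
  "symmetry_plane T N \<longleftrightarrow> spacelike_unit N \<and>
     (\<exists>\<sigma> \<tau>. homeomorphism thrice_punctured_sphere thrice_punctured_sphere \<sigma> \<tau> \<and>
        (\<forall>z\<in>thrice_punctured_sphere. T (\<sigma> z) = hyp_reflection N (T z)))"

text \<open>
  The asymptotic endpoints of a trinoid form its asymptotic boundary: the surface is proper, and
  each of its ends converges to a single point at infinity.
\<close>

definition symmetric_trinoid :: "(complex \<Rightarrow> complex^2^2) \<Rightarrow> real \<Rightarrow> real \<Rightarrow> real \<Rightarrow> bool" where
  "symmetric_trinoid T l1 l2 l3 \<longleftrightarrow> trinoid T l1 l2 l3 \<and>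
     (\<exists>N. symmetry_plane T N \<and>
        asymptotic_boundary (T ` thrice_punctured_sphere) \<subseteq> asymptotic_boundary (hyp_plane N))"


section \<open>Admissible and generic triples\<close>

text \<open>
  An oriented line is the pair of its set of points and its unit direction vector.
\<close>

type_synonym oriented_line = "(real^3) set \<times> (real^3)"

definition is_oriented_line :: "oriented_line \<Rightarrow> bool" where
  "is_oriented_line l \<longleftrightarrow>
     norm (snd l) = 1 \<and> (\<exists>a. fst l = range (\<lambda>s. a + s *\<^sub>R snd l))"

definition reverse_line :: "oriented_line \<Rightarrow> oriented_line" where
  "reverse_line l = (fst l, - snd l)"

definition rigid_motion :: "real^3^3 \<Rightarrow> real^3 \<Rightarrow> real^3 \<Rightarrow> real^3" where
  "rigid_motion Q c p = Q *v p + c"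

definition move_line :: "real^3^3 \<Rightarrow> real^3 \<Rightarrow> oriented_line \<Rightarrow> oriented_line" where
  "move_line Q c l = (rigid_motion Q c ` fst l, Q *v snd l)"

definition helicoid :: "real \<Rightarrow> complex \<Rightarrow> real^3" where
  "helicoid l z = (2 * l) *\<^sub>R
     vector [sinh (Re z) * sin (Im z), - sinh (Re z) * cos (Im z), - Im z]"

text \<open>
  The screw motion \<open>p \<mapsto> screw_rot t *v p + screw_trans l t\<close> maps \<open>helicoid l (x + i y)\<close> to
  \<open>helicoid l (x + i (y + t))\<close>.
\<close>

definition screw_rot :: "real \<Rightarrow> real^3^3" where
  "screw_rot t = vector [vector [cos t, - sin t, 0], vector [sin t, cos t, 0], vector [0, 0, 1]]"

definition screw_trans :: "real \<Rightarrow> real \<Rightarrow> real^3" where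
  "screw_trans l t = vector [0, 0, - 2 * l * t]"

definition h_dist :: "real \<Rightarrow> real" where
  "h_dist \<phi> = 2 * \<bar>the_inv_into lam_range phi_of \<phi>\<bar> * \<phi>"

text \<open>
  Both lines lie on the moved helicoid with parameter \<open>l\<close>, and the moved screw motion takes \<open>k\<close> to
  the reversed line \<open>k'\<close>; here \<open>m\<close> is the position of \<open>k\<close> before the helicoid is moved.
\<close>

definition helicoid_joint :: "real \<Rightarrow> oriented_line \<Rightarrow> oriented_line \<Rightarrow> bool" where
  "helicoid_joint l k k' \<longleftrightarrow>
     (\<exists>Q c. rotation_matrix Q \<and>
        fst k \<subseteq> rigid_motion Q c ` range (helicoid l) \<and>
        fst k' \<subseteq> rigid_motion Q c ` range (helicoid l) \<and>
        (\<exists>t m. k = move_line Q c m \<and>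
           move_line Q c (move_line (screw_rot t) (screw_trans l t) m) = reverse_line k')) \<and>
     setdist (fst k) (fst k') = h_dist (phi_of l)"

definition admissible_constellation ::
  "real \<Rightarrow> real \<Rightarrow> real \<Rightarrow> oriented_line \<Rightarrow> oriented_line \<Rightarrow> oriented_line \<Rightarrow> bool" where
  "admissible_constellation \<mu>1 \<mu>2 \<mu>3 l12 l23 l31 \<longleftrightarrow>
     \<mu>1 \<in> lam_range \<and> \<mu>2 \<in> lam_range \<and> \<mu>3 \<in> lam_range \<and>
     is_oriented_line l12 \<and> is_oriented_line l23 \<and> is_oriented_line l31 \<and>
     helicoid_joint \<mu>1 l12 l31 \<and> helicoid_joint \<mu>2 l23 l12 \<and> helicoid_joint \<mu>3 l31 l23"

definition in_parallel_planes :: "oriented_line \<Rightarrow> oriented_line \<Rightarrow> oriented_line \<Rightarrow> bool" where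
  "in_parallel_planes k l m \<longleftrightarrow>
     (\<exists>n. n \<noteq> 0 \<and> n \<bullet> snd k = 0 \<and> n \<bullet> snd l = 0 \<and> n \<bullet> snd m = 0)"

definition constellation_for_angles ::
  "real \<Rightarrow> real \<Rightarrow> real \<Rightarrow> oriented_line \<Rightarrow> oriented_line \<Rightarrow> oriented_line \<Rightarrow> bool" where
  "constellation_for_angles \<phi>1 \<phi>2 \<phi>3 = admissible_constellation (the_inv_into lam_range phi_of \<phi>1)
     (the_inv_into lam_range phi_of \<phi>2) (the_inv_into lam_range phi_of \<phi>3)"

definition admissible_triple :: "real \<Rightarrow> real \<Rightarrow> real \<Rightarrow> bool" where
  "admissible_triple \<phi>1 \<phi>2 \<phi>3 \<longleftrightarrow> {\<phi>1, \<phi>2, \<phi>3} \<subseteq> phi_range \<and>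
     (\<exists>l12 l23 l31. constellation_for_angles \<phi>1 \<phi>2 \<phi>3 l12 l23 l31)"

definition generic_triple :: "real \<Rightarrow> real \<Rightarrow> real \<Rightarrow> bool" where
  "generic_triple \<phi>1 \<phi>2 \<phi>3 \<longleftrightarrow> admissible_triple \<phi>1 \<phi>2 \<phi>3 \<and>
     (\<exists>l12 l23 l31. constellation_for_angles \<phi>1 \<phi>2 \<phi>3 l12 l23 l31 \<and>
        \<not> in_parallel_planes l12 l23 l31)"

text \<open>The infimum is attained.\<close>

definition reduced_angle :: "real \<Rightarrow> real" where
  "reduced_angle \<phi> = (INF n::int. \<bar>\<phi> + 2 * of_int n * pi\<bar>)"

definition tetrahedron_interior :: "(real^3) set" where
  "tetrahedron_interior = interior (convex hull
     {vector [pi, 0, 0], vector [0, pi, 0], vector [0, 0, pi], vector [pi, pi, pi]})"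

end

theory Submission
  imports Defs
begin

text \<open>
  Genericity alone forces the conclusion. A line on a helicoid is a ruling or the axis, and the
  axis is excluded because two lines of a constellation have positive distance. Comparing distances,
  the screw motion joining two of the lines has angle \<open>\<plusminus> \<phi>\<^sub>i\<close>, so the three unit directions have the
  pairwise inner products \<open>- cos \<phi>\<^sub>i = - cos (r \<phi>\<^sub>i)\<close>. For linearly independent directions the Gram
  determinant is positive; this says that the numbers \<open>\<pi> - r \<phi>\<^sub>i\<close> satisfy the strict triangle
  inequalities of a nondegenerate spherical triangle, which are the inequalities describing the
  four faces of the tetrahedron.
\<close>

section \<open>Straight lines on a helicoid\<close>

lemma helicoid_equation:
  assumes "p \<in> range (helicoid l)" "l \<noteq> 0"
  shows "p $ 1 * cos (p $ 3 / (2 * l)) = p $ 2 * sin (p $ 3 / (2 * l))"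
  using assms by (auto simp: helicoid_def)

text \<open>At constant height the helicoid equation is linear, which forces the line through the
  axis; \<open>s\<close> is the parameter of the intersection. A line of varying height passes every
  angle, and periodicity puts it on the axis.\<close>

lemma line_in_helicoid:
  fixes a d :: "real^3"
  assumes l: "l \<noteq> 0" and d: "norm d = 1"
    and sub: "range (\<lambda>s. a + s *\<^sub>R d) \<subseteq> range (helicoid l)"
  obtains (ruling) s where "d $ 3 = 0" "(a + s *\<^sub>R d) $ 1 = 0" "(a + s *\<^sub>R d) $ 2 = 0"
    | (axis) "a $ 1 = 0" "a $ 2 = 0" "d $ 1 = 0" "d $ 2 = 0"
proof -
  have eq: "(a $ 1 + s * d $ 1) * cos ((a $ 3 + s * d $ 3) / (2 * l))
      = (a $ 2 + s * d $ 2) * sin ((a $ 3 + s * d $ 3) / (2 * l))" for s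
    using helicoid_equation[OF subsetD[OF sub rangeI[of _ s]] l] by simp
  show ?thesis
  proof (cases "d $ 3 = 0")
    case True
    define c where "c = cos (a $ 3 / (2 * l))"
    define e where "e = sin (a $ 3 / (2 * l))"
    have ce: "c\<^sup>2 + e\<^sup>2 = 1"
      by (simp add: c_def e_def)
    have a0: "a $ 1 * c = a $ 2 * e" and "(a $ 1 + d $ 1) * c = (a $ 2 + d $ 2) * e"
      using eq[of 0] eq[of 1] True by (simp_all add: c_def e_def)
    then have d0: "d $ 1 * c = d $ 2 * e"
      by (simp add: algebra_simps)
    \<comment> \<open>The horizontal parts of \<open>a\<close> and \<open>d\<close> are both
      orthogonal to the unit vector \<open>(c, - e)\<close>, hence parallel.\<close>
    have "c * (a $ 1 * d $ 2 - a $ 2 * d $ 1) = 0" "e * (a $ 1 * d $ 2 - a $ 2 * d $ 1) = 0"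
      using a0 d0 by algebra+
    then have cross: "a $ 1 * d $ 2 = a $ 2 * d $ 1"
      using ce by auto
    have "d \<bullet> d = 1"
      using d by (simp add: norm_eq_1)
    then have dd: "d $ 1 * d $ 1 + d $ 2 * d $ 2 = 1"
      using True by (simp add: inner_vec_def sum_3)
    \<comment> \<open>Parameter of the point closest to the axis; as the horizontal parts are
      parallel, this point lies on the axis.\<close>
    define s where "s = - (a $ 1 * d $ 1 + a $ 2 * d $ 2)"
    have "(a + s *\<^sub>R d) $ 1 = 0" "(a + s *\<^sub>R d) $ 2 = 0"
      using cross dd unfolding s_def by (simp, algebra)+
    then show ?thesis
      using ruling True by blast
  next
    case False
    \<comment> \<open>Reparametrization by the angle \<open>\<theta>\<close>, the height divided by
      \<open>2 * l\<close>.\<close>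
    have eq': "(a $ 1 + ((2 * l * \<theta> - a $ 3) / d $ 3) * d $ 1) * cos \<theta>
        = (a $ 2 + ((2 * l * \<theta> - a $ 3) / d $ 3) * d $ 2) * sin \<theta>" for \<theta>
      using eq[of "(2 * l * \<theta> - a $ 3) / d $ 3"] False l by simp
    \<comment> \<open>An affine function of the angle with two zeros a full turn apart is zero. The
      angle 0 isolates the first coordinate, \<open>pi / 2\<close> the second.\<close>
    have vanish: "x = 0 \<and> y = 0"
      if "x + ((2 * l * \<alpha> - a $ 3) / d $ 3) * y = 0"
        "x + ((2 * l * (\<alpha> + 2 * pi) - a $ 3) / d $ 3) * y = 0" for x y \<alpha>
    proof -
      have "((2 * l * (\<alpha> + 2 * pi) - a $ 3) / d $ 3) * y - ((2 * l * \<alpha> - a $ 3) / d $ 3) * y = 0"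
        using that by linarith
      then have "4 * l * pi * y = 0"
        using False by (simp add: field_simps)
      then show ?thesis
        using that l by simp
    qed
    have "a $ 1 = 0 \<and> d $ 1 = 0"
      using vanish[of "a $ 1" 0 "d $ 1"] eq'[of 0] eq'[of "0 + 2 * pi"] by simp
    moreover have "a $ 2 = 0 \<and> d $ 2 = 0"
      using vanish[of "a $ 2" "pi / 2" "d $ 2"] eq'[of "pi / 2"] eq'[of "pi / 2 + 2 * pi"]
      by (simp only: sin_periodic cos_periodic) simp
    ultimately show ?thesis
      using axis by blast
  qed
qed

section \<open>The parameter bijection\<close>

lemma phi_of_pos: "l \<in> lam_range \<Longrightarrow> phi_of l > 0"
  by (simp add: lam_range_def phi_of_def)

lemma inj_on_phi_of: "inj_on phi_of lam_range"
  by (rule inj_onI) (auto simp: phi_of_def lam_range_def field_simps)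

lemma phi_range_subset: "phi_range \<subseteq> phi_of ` lam_range"
proof
  fix \<phi> assume "\<phi> \<in> phi_range"
  then have \<phi>: "\<phi> > 0" "\<phi> \<noteq> pi"
    by (auto simp: phi_range_def)
  define l where "l = ((pi / \<phi>)\<^sup>2 - 1) / 4"
  have *: "1 + 4 * l = (pi / \<phi>)\<^sup>2"
    by (simp add: l_def field_simps)
  then have "phi_of l = \<phi>"
    using \<phi> by (simp add: phi_of_def real_sqrt_abs)
  moreover have "l > -1/4"
    using * zero_less_power[OF divide_pos_pos[OF pi_gt_zero \<phi>(1)], of 2] by linarith
  moreover have "l \<noteq> 0"
    using \<open>phi_of l = \<phi>\<close> \<phi> by (auto simp: phi_of_def)
  ultimately show "\<phi> \<in> phi_of ` lam_range"
    by (auto simp: lam_range_def)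
qed

lemma h_dist_phi_of: "l \<in> lam_range \<Longrightarrow> h_dist (phi_of l) = 2 * \<bar>l\<bar> * phi_of l"
  by (simp add: h_dist_def the_inv_into_f_f inj_on_phi_of)

section \<open>Angles between joined lines\<close>

lemma orthogonal_matrix_inner:
  "orthogonal_matrix Q \<Longrightarrow> (Q *v x) \<bullet> (Q *v y) = x \<bullet> (y :: real^'n)"
  by (metis orthogonal_transformation_def orthogonal_transformation_matrix matrix_of_matrix_vector_mul
      matrix_vector_mul_linear)

lemma dist_rigid_motion:
  "orthogonal_matrix Q \<Longrightarrow> dist (rigid_motion Q c x) (rigid_motion Q c y) = dist x y"
  by (simp add: rigid_motion_def dist_norm norm_eq_sqrt_inner orthogonal_matrix_inner
      flip: matrix_vector_mult_diff_distrib)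

text \<open>Everything is pulled back to the unmoved helicoid. There the screw motion turns a ruling
  by \<open>t\<close> while shifting its height by \<open>2 * l * t\<close>, so the prescribed
  distance fixes \<open>t\<close> up to sign. The minus sign comes from the reversed orientation of
  \<open>k'\<close>.\<close>

lemma helicoid_joint_inner:
  assumes joint: "helicoid_joint l k k'" and k: "is_oriented_line k" and l: "l \<in> lam_range"
  shows "snd k \<bullet> snd k' = - cos (phi_of l)"
proof -
  obtain Q c t m where Q: "orthogonal_matrix Q"
    and sub: "fst k \<subseteq> rigid_motion Q c ` range (helicoid l)"
    and km: "k = move_line Q c m"
    and k'm: "move_line Q c (move_line (screw_rot t) (screw_trans l t) m) = reverse_line k'"
    and "setdist (fst k) (fst k') = h_dist (phi_of l)"
    using joint unfolding helicoid_joint_def rotation_matrix_def by blast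
  then have sd: "setdist (fst k) (fst k') = 2 * \<bar>l\<bar> * phi_of l"
    using l by (simp add: h_dist_phi_of)
  have l0: "l \<noteq> 0"
    using l by (simp add: lam_range_def)
  define M where "M = rigid_motion Q c"
  define S where "S = rigid_motion (screw_rot t) (screw_trans l t)"
  define d where "d = snd m"
  have distM: "dist (M x) (M y) = dist x y" for x y
    using Q by (simp add: M_def dist_rigid_motion)
  then have injM: "inj M"
    by (metis dist_eq_0_iff injI)
  have fk: "fst k = M ` fst m" and sk: "snd k = Q *v d"
    by (simp_all add: km move_line_def M_def d_def)
  have fk': "fst k' = M ` S ` fst m" and sk': "snd k' = - (Q *v (screw_rot t *v d))"
    using arg_cong[OF k'm, of fst] arg_cong[OF k'm, of "\<lambda>x. - snd x"]
    by (simp_all add: move_line_def M_def S_def d_def reverse_line_def)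
  have screw: "S p $ 1 = cos t * p $ 1 - sin t * p $ 2" "S p $ 2 = sin t * p $ 1 + cos t * p $ 2"
    "S p $ 3 = p $ 3 - 2 * l * t" for p
    by (simp_all add: S_def rigid_motion_def screw_rot_def screw_trans_def
        matrix_vector_mult_def sum_3)
  obtain b where norm_k: "norm (Q *v d) = 1" and b: "fst k = range (\<lambda>s. b + s *\<^sub>R (Q *v d))"
    using k by (auto simp: is_oriented_line_def sk)
  have nd: "norm d = 1"
    using norm_k Q by (simp add: norm_eq_sqrt_inner orthogonal_matrix_inner)
  have "b \<in> M ` fst m"
    unfolding fk[symmetric] b by (auto intro: range_eqI[of _ _ 0])
  then obtain a where a: "b = M a"
    by blast
  have "M (a + s *\<^sub>R d) = b + s *\<^sub>R (Q *v d)" for s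
    by (simp add: a M_def rigid_motion_def matrix_vector_right_distrib matrix_vector_mult_scaleR)
  then have "M ` range (\<lambda>s. a + s *\<^sub>R d) = M ` fst m"
    unfolding fk[symmetric] b by (auto simp: image_image)
  then have fm: "fst m = range (\<lambda>s. a + s *\<^sub>R d)"
    using injM by (simp add: inj_image_eq_iff)
  have "fst m \<subseteq> range (helicoid l)"
    using sub injM unfolding fk M_def[symmetric] by (simp add: inj_image_subset_iff)
  then have "range (\<lambda>s. a + s *\<^sub>R d) \<subseteq> range (helicoid l)"
    by (simp add: fm)
  from l0 nd this show ?thesis
  proof (cases rule: line_in_helicoid)
    case (ruling s0)
    define p where "p = a + s0 *\<^sub>R d"
    have p: "p \<in> fst m" "p $ 1 = 0" "p $ 2 = 0"
      using ruling by (auto simp: fm p_def)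
    have height: "x $ 3 = a $ 3" if "x \<in> fst m" for x
      using that ruling by (auto simp: fm)
    \<comment> \<open>Both lines are horizontal, so their height difference bounds the distance from
      below; the point \<open>p\<close> on the axis attains it.\<close>
    have low: "\<bar>2 * l * t\<bar> \<le> dist x (S y)" if "x \<in> fst m" "y \<in> fst m" for x y
      using component_le_norm_cart[of "x - S y" 3] that by (simp add: screw height dist_norm)
    have "p - S p = (2 * l * t) *\<^sub>R axis 3 1"
      using p by (auto simp: vec_eq_iff forall_3 screw axis_def)
    then have att: "dist p (S p) = \<bar>2 * l * t\<bar>"
      by (simp add: dist_norm)
    have "setdist (fst k) (fst k') = dist (M p) (M (S p))"
      unfolding fk fk' by (rule setdist_unique) (use p low att distM in auto)
    then have "2 * \<bar>l\<bar> * \<bar>t\<bar> = 2 * \<bar>l\<bar> * phi_of l"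
      by (auto simp: distM att sd abs_mult)
    then have "\<bar>t\<bar> = phi_of l"
      using l0 by auto
    then have ct: "cos (phi_of l) = cos t"
      by (metis cos_abs_real)
    have "d \<bullet> d = 1"
      using nd by (simp add: norm_eq_1)
    then have dd: "d $ 1 * d $ 1 + d $ 2 * d $ 2 = 1"
      using ruling by (simp add: inner_vec_def sum_3)
    have "snd k \<bullet> snd k' = - (d \<bullet> (screw_rot t *v d))"
      using Q by (simp add: sk sk' orthogonal_matrix_inner)
    also have "d \<bullet> (screw_rot t *v d) = cos t * (d $ 1 * d $ 1 + d $ 2 * d $ 2)"
      using ruling by (simp add: inner_vec_def sum_3 screw_rot_def matrix_vector_mult_def algebra_simps)
    finally show ?thesis
      by (simp add: dd ct)
  next
    case axis
    have d3: "d $ 3 \<noteq> 0"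
      using nd axis by (auto simp: norm_vec_def L2_set_def sum_3)
    \<comment> \<open>The screw motion slides the axis along itself, so the two lines would
      coincide, against their positive distance.\<close>
    have "S a = a + (- 2 * l * t / d $ 3) *\<^sub>R d"
      using axis d3 by (simp add: vec_eq_iff forall_3 screw)
    then have "S a \<in> fst m"
      unfolding fm by (rule range_eqI)
    moreover have "a \<in> fst m"
      by (auto simp: fm intro: range_eqI[of _ _ 0])
    ultimately have "setdist (fst k) (fst k') = 0"
      unfolding fk fk' by (intro setdist_eq_0I[of "M (S a)"]) auto
    then show ?thesis
      using sd l0 phi_of_pos[OF l] by simp
  qed
qed

section \<open>The Gram determinant and its trigonometric meaning\<close>

lemma gram_pos:
  fixes u v w :: "real^3"
  assumes "norm u = 1" "norm v = 1" "norm w = 1"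
    and indep: "\<nexists>n. n \<noteq> 0 \<and> n \<bullet> u = 0 \<and> n \<bullet> v = 0 \<and> n \<bullet> w = 0"
  shows "0 < 1 + 2 * (u \<bullet> v) * (v \<bullet> w) * (w \<bullet> u) - (u \<bullet> v)\<^sup>2 - (v \<bullet> w)\<^sup>2 - (w \<bullet> u)\<^sup>2"
proof -
  define A :: "real^3^3" where "A = vector [u, v, w]"
  have "n = 0" if "A *v n = 0" for n
  proof (rule ccontr)
    assume "n \<noteq> 0"
    moreover have "n \<bullet> u = 0" "n \<bullet> v = 0" "n \<bullet> w = 0"
      using that by (simp_all add: vec_eq_iff forall_3 A_def matrix_vector_mul_component inner_commute)
    ultimately show False
      using indep by blast
  qed
  then have "det A \<noteq> 0"
    using matrix_left_invertible_ker invertible_det_nz invertible_left_inverse by blast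
  then have "0 < (det A)\<^sup>2"
    by simp
  also have "(det A)\<^sup>2 = det (A ** transpose A)"
    by (simp add: det_mul det_transpose power2_eq_square)
  also have "A ** transpose A = vector [vector [u \<bullet> u, u \<bullet> v, u \<bullet> w],
      vector [v \<bullet> u, v \<bullet> v, v \<bullet> w], vector [w \<bullet> u, w \<bullet> v, w \<bullet> w]]"
    by (simp add: vec_eq_iff forall_3 matrix_matrix_mult_def transpose_def A_def inner_vec_def)
  also have "det \<dots> = 1 + 2 * (u \<bullet> v) * (v \<bullet> w) * (w \<bullet> u) - (u \<bullet> v)\<^sup>2 - (v \<bullet> w)\<^sup>2 - (w \<bullet> u)\<^sup>2"
    using assms(1-3)
    by (simp add: det_3 norm_eq_1 inner_commute power2_eq_square algebra_simps)
  finally show ?thesis .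
qed

text \<open>Numbers with equal cosine agree up to sign and multiples of \<open>2 * pi\<close>. The
  closed form shows that reduction preserves the cosine.\<close>

lemma reduced_angle_eq: "reduced_angle \<phi> = arccos (cos \<phi>)"
proof -
  have "arccos (cos \<phi>) \<in> range (\<lambda>n::int. \<bar>\<phi> + 2 * of_int n * pi\<bar>)"
  proof -
    define r where "r = arccos (cos \<phi>)"
    have r: "r \<ge> 0" "cos r = cos \<phi>"
      by (simp_all add: r_def arccos_lbound)
    then obtain x where x: "x \<in> \<int>" "r = \<phi> + 2 * x * pi \<or> r = - \<phi> + 2 * x * pi"
      using cos_eq by blast
    then obtain n :: int where n: "x = of_int n"
      by (auto elim: Ints_cases)
    have "r = \<bar>\<phi> + 2 * of_int n * pi\<bar> \<or> r = \<bar>\<phi> + 2 * of_int (- n) * pi\<bar>"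
      using x n r by auto
    then show ?thesis
      unfolding r_def[symmetric] by blast
  qed
  moreover have "arccos (cos \<phi>) \<le> \<bar>\<phi> + 2 * of_int n * pi\<bar>" for n :: int
  proof -
    define x where "x = \<bar>\<phi> + 2 * of_int n * pi\<bar>"
    have "cos x = cos \<phi>"
      unfolding x_def cos_abs_real
      using cos.plus_of_int[of \<phi> n] by (simp add: mult_ac)
    \<comment> \<open>For \<open>x\<close> beyond \<open>pi\<close> the bound \<open>pi\<close> on
      \<open>arccos\<close> suffices.\<close>
    moreover have "arccos (cos x) \<le> x"
      using arccos_cos[of x] arccos_ubound[of "cos x"] by (cases "x \<le> pi") (auto simp: x_def)
    ultimately show ?thesis
      by (simp add: x_def)
  qed
  ultimately show ?thesis
    unfolding reduced_angle_def by (intro cInf_eq_minimum) auto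
qed

text \<open>The Gram expression is a difference of two squares. Its positivity places
  \<open>cos c\<close> strictly between \<open>- cos (a - b)\<close> and
  \<open>- cos (a + b)\<close>, and the cosine is strictly decreasing on
  \<open>{0..pi}\<close>.\<close>

lemma gram_pos_imp_triangle_inequalities:
  fixes a b c :: real
  assumes a: "a \<in> {0..pi}" and b: "b \<in> {0..pi}" and c: "c \<in> {0..pi}"
    and gram: "0 < 1 - 2 * cos a * cos b * cos c - (cos a)\<^sup>2 - (cos b)\<^sup>2 - (cos c)\<^sup>2"
  shows "a + b + c > pi" "a + b - c < pi" "a - b + c < pi" "- a + b + c < pi"
proof -
  have "(sin a * sin b)\<^sup>2 - (cos c + cos a * cos b)\<^sup>2
      = 1 - 2 * cos a * cos b * cos c - (cos a)\<^sup>2 - (cos b)\<^sup>2 - (cos c)\<^sup>2"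
    unfolding power_mult_distrib sin_squared_eq by (simp add: power2_eq_square algebra_simps)
  then have "(cos c + cos a * cos b)\<^sup>2 < (sin a * sin b)\<^sup>2"
    using gram by linarith
  moreover have "0 \<le> sin a * sin b"
    using a b by (simp add: sin_ge_zero)
  ultimately have lt: "\<bar>cos c + cos a * cos b\<bar> < sin a * sin b"
    using abs_square_less_1 power2_less_imp_less[of "\<bar>cos c + cos a * cos b\<bar>" "sin a * sin b"]
    by simp
  \<comment> \<open>The absolute value keeps the argument in \<open>{0..pi}\<close> and yields two
    of the inequalities at once.\<close>
  have "cos c < cos \<bar>pi - (a + b)\<bar>"
    using lt by (simp add: cos_diff cos_add abs_less_iff)
  then have "\<bar>pi - (a + b)\<bar> < c"
    using a b c by (subst (asm) cos_mono_less_eq) (auto simp: abs_le_iff)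
  then show "a + b + c > pi" "a + b - c < pi"
    by (auto simp: abs_less_iff)
  have "cos (pi - \<bar>a - b\<bar>) < cos c"
    using lt by (simp add: cos_diff abs_less_iff)
  then have "c < pi - \<bar>a - b\<bar>"
    using a b c by (subst (asm) cos_mono_less_eq) (auto simp: abs_le_iff)
  then show "a - b + c < pi" "- a + b + c < pi"
    by linarith+
qed

section \<open>The tetrahedron\<close>

text \<open>The four strict inequalities cut out an open set. Explicit barycentric coordinates put
  it inside the hull, hence inside the interior.\<close>

lemma tetrahedron_interiorI:
  fixes x y z :: real
  assumes "x + y + z > pi" "x + y - z < pi" "x - y + z < pi" "- x + y + z < pi"
  shows "vector [x, y, z] \<in> tetrahedron_interior"
proof -
  define V :: "(real^3) set"
    where "V = {vector [pi, 0, 0], vector [0, pi, 0], vector [0, 0, pi], vector [pi, pi, pi]}"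
  define S :: "(real^3) set" where "S = {p. p $ 1 + p $ 2 + p $ 3 > pi} \<inter> {p. p $ 1 + p $ 2 - p $ 3 < pi} \<inter>
    {p. p $ 1 - p $ 2 + p $ 3 < pi} \<inter> {p. - p $ 1 + p $ 2 + p $ 3 < pi}"
  have "open S"
    unfolding S_def by (intro open_Int open_Collect_less continuous_intros)
  moreover have "S \<subseteq> convex hull V"
  proof
    fix p assume p: "p \<in> S"
    \<comment> \<open>Barycentric coordinate of the vertex \<open>(pi, pi, pi)\<close>, zero on the
      opposite face. Each of the four inequalities makes one coordinate nonnegative.\<close>
    define e where "e = (p $ 1 + p $ 2 + p $ 3 - pi) / (2 * pi)"
    have pos: "0 \<le> p $ 1 / pi - e" "0 \<le> p $ 2 / pi - e" "0 \<le> p $ 3 / pi - e" "0 \<le> e"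
      using p by (auto simp: S_def e_def field_simps)
    have sum: "(p $ 1 / pi - e) + (p $ 2 / pi - e) + (p $ 3 / pi - e) + e = 1"
      by (simp add: e_def field_simps)
    have "p = (p $ 1 / pi - e) *\<^sub>R vector [pi, 0, 0] + (p $ 2 / pi - e) *\<^sub>R vector [0, pi, 0]
        + (p $ 3 / pi - e) *\<^sub>R vector [0, 0, pi] + e *\<^sub>R vector [pi, pi, pi]"
      by (simp add: vec_eq_iff forall_3 field_simps)
    moreover have "\<alpha> *\<^sub>R q1 + \<beta> *\<^sub>R q2 + \<gamma> *\<^sub>R q3 + \<delta> *\<^sub>R q4 \<in> convex hull {q1, q2, q3, q4}"
      if "0 \<le> \<alpha>" "0 \<le> \<beta>" "0 \<le> \<gamma>" "0 \<le> \<delta>" "\<alpha> + \<beta> + \<gamma> + \<delta> = 1" for \<alpha> \<beta> \<gamma> \<delta> and q1 q2 q3 q4 :: "real^3"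
    proof -
      define f where "f i = [q1, q2, q3, q4] ! i" for i
      define g where "g i = [\<alpha>, \<beta>, \<gamma>, \<delta>] ! i" for i
      have "(\<Sum>i<4. g i *\<^sub>R f i) \<in> convex hull {q1, q2, q3, q4}"
      proof (rule convex_sum)
        show "(\<Sum>i<4. g i) = 1"
          using that by (simp add: g_def eval_nat_numeral)
        show "0 \<le> g i" "f i \<in> convex hull {q1, q2, q3, q4}" if i: "i \<in> {..<4}" for i
        proof -
          consider "i = 0" | "i = 1" | "i = 2" | "i = 3"
            using i by force
          then show "0 \<le> g i" "f i \<in> convex hull {q1, q2, q3, q4}"
            using \<open>0 \<le> \<alpha>\<close> \<open>0 \<le> \<beta>\<close> \<open>0 \<le> \<gamma>\<close> \<open>0 \<le> \<delta>\<close>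
            by (cases; simp add: g_def f_def hull_inc)+
        qed
      qed auto
      then show ?thesis
        by (simp add: f_def g_def eval_nat_numeral)
    qed
    ultimately show "p \<in> convex hull V"
      unfolding V_def using pos sum by metis
  qed
  ultimately have "S \<subseteq> interior (convex hull V)"
    by (simp add: interior_maximal)
  then show ?thesis
    using assms by (auto simp: tetrahedron_interior_def V_def S_def)
qed

theorem theorem2:
  fixes \<phi>1 \<phi>2 \<phi>3 :: real
  assumes "\<phi>1 \<in> phi_range - range (\<lambda>n::int. of_int n * pi)"
    and "\<phi>2 \<in> phi_range - range (\<lambda>n::int. of_int n * pi)"
    and "\<phi>3 \<in> phi_range - range (\<lambda>n::int. of_int n * pi)"
    and "\<exists>T \<mu>1 \<mu>2 \<mu>3. symmetric_trinoid T \<mu>1 \<mu>2 \<mu>3 \<and>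
           phi_of \<mu>1 = \<phi>1 \<and> phi_of \<mu>2 = \<phi>2 \<and> phi_of \<mu>3 = \<phi>3"
    and "generic_triple \<phi>1 \<phi>2 \<phi>3"
  shows "vector [reduced_angle \<phi>1, reduced_angle \<phi>2, reduced_angle \<phi>3] \<in> tetrahedron_interior"
proof -
  obtain l12 l23 l31 where const: "constellation_for_angles \<phi>1 \<phi>2 \<phi>3 l12 l23 l31"
    and indep: "\<not> in_parallel_planes l12 l23 l31"
    using assms(5) by (auto simp: generic_triple_def)
  have inv: "phi_of (the_inv_into lam_range phi_of \<phi>) = \<phi>" if "\<phi> \<in> phi_range" for \<phi>
    using that phi_range_subset by (intro f_the_inv_into_f inj_on_phi_of) auto
  define u where "u = snd l12"
  define v where "v = snd l23"
  define w where "w = snd l31"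
  \<comment> \<open>The joint at end 1 links \<open>l12\<close> with \<open>l31\<close>, and so on
    cyclically.\<close>
  have "u \<bullet> w = - cos \<phi>1" "v \<bullet> u = - cos \<phi>2" "w \<bullet> v = - cos \<phi>3"
    using const assms(1-3) inv helicoid_joint_inner
    unfolding constellation_for_angles_def admissible_constellation_def u_def v_def w_def
    by (metis DiffD1)+
  then have inner: "w \<bullet> u = - cos \<phi>1" "u \<bullet> v = - cos \<phi>2" "v \<bullet> w = - cos \<phi>3"
    by (simp_all add: inner_commute)
  have norms: "norm u = 1" "norm v = 1" "norm w = 1"
    using const
    by (auto simp: constellation_for_angles_def admissible_constellation_def is_oriented_line_def
        u_def v_def w_def)
  \<comment> \<open>The product of the three inner products carries a minus sign, the squares do
    not.\<close>
  have "0 < 1 - 2 * cos \<phi>1 * cos \<phi>2 * cos \<phi>3 - (cos \<phi>1)\<^sup>2 - (cos \<phi>2)\<^sup>2 - (cos \<phi>3)\<^sup>2"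
    using gram_pos[OF norms] indep
    by (simp add: in_parallel_planes_def inner mult_ac flip: u_def v_def w_def)
  \<comment> \<open>Since \<open>cos (arccos (cos \<phi>)) = cos \<phi>\<close>, the Gram inequality
    holds for the reduced angles, which lie in \<open>{0..pi}\<close>.\<close>
  then show ?thesis
    unfolding reduced_angle_eq
    by (intro tetrahedron_interiorI gram_pos_imp_triangle_inequalities)
      (simp_all add: arccos_lbound arccos_ubound)
qed

end
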